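(* Consider a two-stripe symmetric circulant TSP instance with parameters $n, a_1, a_2$ satisfying the standing assumptions below, and let $g_1=\gcd(n,a_1)$. Let $k<2(g_1-1)$ be an integer and let $x$ be the unique solution of $x a_1 \equiv -g_1 a_2 \pmod n$ in $\{0,1,\dots,\frac{n}{g_1}-1\}$. Then there exists a Hamiltonian cycle of cost $k$ in the instance if and only if there is a Hamiltonian path in the $r\times c$ cylinder graph with $c=g_1$ and $r=\frac{n}{g_1}$ that uses exactly $k-1$ horizontal edges, starts at $(0,0)$, and ends at $(x,c-1)$.
   Context: Two-stripe symmetric circulant TSP: the vertex set is $\mathbb{Z}_n$, and for two distinct integers $a_1,a_2\in\{1,\dots,\lfloor n/2\rfloor\}$ the only finite-cost edges are $\{v,v\pm a_1 \bmod n\}$ (cost $0$) and $\{v,v\pm a_2\bmod n\}$ (cost $1$); the cost of a Hamiltonian cycle is its number of edges of length $a_2$. Standing assumptions: $g_1=\gcd(n,a_1)>1$ and $\gcd(n,a_1,a_2)=1$. An $r\times c$ cylinder graph has vertices $(i,j)$, $0\le i\le r-1$, $0\le j\le c-1$; vertex $(i,j)$ is adjacent to $(i,j+1)$ if $j<c-1$ and to $(i,j-1)$ if $j>0$ (these are horizontal edges, cost $1$), and to $(i-1 \bmod r, j)$ and $(i+1\bmod r,j)$ (vertical edges, cost $0$). *)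

theory Defs
  imports "HOL-Number_Theory.Number_Theory"
begin

text \<open>
  A simple graph is given by its vertex set and its set of edges, an edge being the
  two-element set of its ends.
\<close>

definition path_edges :: "'a list \<Rightarrow> 'a set set" where
  "path_edges p = {{p ! i, p ! Suc i} | i. Suc i < length p}"

definition cycle_edges :: "'a list \<Rightarrow> 'a set set" where
  "cycle_edges p = insert {last p, hd p} (path_edges p)"

definition hamiltonian_path :: "'a set \<Rightarrow> 'a set set \<Rightarrow> 'a list \<Rightarrow> bool" where
  "hamiltonian_path V E p \<longleftrightarrow> distinct p \<and> set p = V \<and> path_edges p \<subseteq> E"

text \<open>
  A cycle is given by the list of its vertices from an arbitrary starting point, without
  repetition of the first vertex at the end. It has at least three vertices, so the edges
  in its edge set are pairwise distinct and the cardinality of a subset of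
  the edge set counts the edges used.
\<close>

definition hamiltonian_cycle :: "'a set \<Rightarrow> 'a set set \<Rightarrow> 'a list \<Rightarrow> bool" where
  "hamiltonian_cycle V E p \<longleftrightarrow>
     length p \<ge> 3 \<and> distinct p \<and> set p = V \<and> cycle_edges p \<subseteq> E"

definition circulant_vertices :: "int \<Rightarrow> int set" where
  "circulant_vertices n = {0..<n}"

definition circulant_stripe :: "int \<Rightarrow> int \<Rightarrow> int set set" where
  "circulant_stripe n a =
     {{v, (v + a) mod n} | v. v \<in> circulant_vertices n} \<union>
     {{v, (v - a) mod n} | v. v \<in> circulant_vertices n}"

text \<open>
  The graph formed by the edges of finite cost; tours of finite cost are exactly its
  Hamiltonian cycles.
\<close>

definition two_stripe_edges :: "int \<Rightarrow> int \<Rightarrow> int \<Rightarrow> int set set" where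
  "two_stripe_edges n a1 a2 = circulant_stripe n a1 \<union> circulant_stripe n a2"

definition tour_cost :: "int \<Rightarrow> int \<Rightarrow> int list \<Rightarrow> nat" where
  "tour_cost n a2 p = card (cycle_edges p \<inter> circulant_stripe n a2)"

definition cylinder_vertices :: "int \<Rightarrow> int \<Rightarrow> (int \<times> int) set" where
  "cylinder_vertices r c = {0..r - 1} \<times> {0..c - 1}"

definition horizontal_edges :: "int \<Rightarrow> int \<Rightarrow> (int \<times> int) set set" where
  "horizontal_edges r c =
     {{(i, j), (i, j + 1)} | i j. (i, j) \<in> cylinder_vertices r c \<and> j < c - 1} \<union>
     {{(i, j), (i, j - 1)} | i j. (i, j) \<in> cylinder_vertices r c \<and> j > 0}"

definition vertical_edges :: "int \<Rightarrow> int \<Rightarrow> (int \<times> int) set set" where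
  "vertical_edges r c =
     {{(i, j), ((i - 1) mod r, j)} | i j. (i, j) \<in> cylinder_vertices r c} \<union>
     {{(i, j), ((i + 1) mod r, j)} | i j. (i, j) \<in> cylinder_vertices r c}"

definition cylinder_edges :: "int \<Rightarrow> int \<Rightarrow> (int \<times> int) set set" where
  "cylinder_edges r c = horizontal_edges r c \<union> vertical_edges r c"

lemma unique_cylinder_row:
  fixes n a1 a2 :: int
  assumes "n > 0"
  shows "\<exists>!x. x \<in> {0..n div gcd n a1 - 1} \<and> [x * a1 = - gcd n a1 * a2] (mod n)"
proof -
  define g where "g = gcd n a1"
  define r where "r = n div g"
  define b where "b = a1 div g"
  have g: "g > 0" using assms by (simp add: g_def)
  have n: "n = g * r" and a: "a1 = g * b" by (simp_all add: r_def b_def g_def)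
  have r: "r > 0" using assms g n by (simp add: zero_less_mult_iff)
  have cop: "coprime b r"
    using assms unfolding r_def b_def g_def
    by (metis coprime_commute div_gcd_coprime less_irrefl)
  have red: "[x * a1 = - g * a2] (mod n) \<longleftrightarrow> [x * b = - a2] (mod r)" for x
  proof -
    have "x * a1 - (- g * a2) = g * (x * b - (- a2))" by (simp add: a algebra_simps)
    then show ?thesis using g by (simp add: cong_iff_dvd_diff n)
  qed
  obtain y where y: "[b * y = 1] (mod r)" using cop cong_solve_coprime_int by blast
  have "\<exists>!x. x \<in> {0..r - 1} \<and> [x * b = - a2] (mod r)"
  proof (rule ex1I[of _ "(y * - a2) mod r"])
    have "[(y * - a2) mod r * b = y * - a2 * b] (mod r)"
      by (intro cong_mult) simp_all
    also have "y * - a2 * b = b * y * - a2" by simp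
    also have "[b * y * - a2 = 1 * - a2] (mod r)" by (intro cong_mult y cong_refl)
    finally show ex: "(y * - a2) mod r \<in> {0..r - 1} \<and> [(y * - a2) mod r * b = - a2] (mod r)"
      using r by simp
    fix x assume x: "x \<in> {0..r - 1} \<and> [x * b = - a2] (mod r)"
    then have "[x * b = (y * - a2) mod r * b] (mod r)"
      using ex cong_trans cong_sym by blast
    then have "[x = (y * - a2) mod r] (mod r)" using cop by (simp add: cong_mult_rcancel)
    then show "x = (y * - a2) mod r" using x r by (simp add: cong_def)
  qed
  then show ?thesis using red by (simp add: g_def r_def)
qed

end

theory Submission
  imports Defs
begin

text \<open>
  The edges of length \<open>a1\<close> stay inside the \<open>g1\<close> cosets of the subgroup generated by \<open>a1\<close>
  (the columns), and those of length \<open>a2\<close> join cyclically consecutive columns, so they fall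
  into \<open>g1\<close> classes, the gaps. A Hamiltonian cycle misses at most one gap, because removing two
  gaps disconnects the columns. If it used no gap exactly once, it would use at least
  \<open>g1 - 1\<close> gaps at least twice each and cost at least \<open>2 (g1 - 1)\<close>. So a cheaper cycle crosses
  some gap by a single edge; removing that edge and unrolling the columns from this gap onwards
  gives the Hamiltonian path of the cylinder, and conversely the edge between
  the images of \<open>(x, g1 - 1)\<close> and \<open>(0, 0)\<close> closes the path.
\<close>

section \<open>Paths and cycles as lists\<close>

lemma path_edges_conv_image: "path_edges p = (\<lambda>i. {p ! i, p ! Suc i}) ` {..<length p - 1}"
  unfolding path_edges_def by force

lemma finite_path_edges [simp]: "finite (path_edges p)"
  by (simp add: path_edges_conv_image)

lemma finite_cycle_edges [simp]: "finite (cycle_edges p)"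
  by (simp add: cycle_edges_def)

lemma path_edges_Nil [simp]: "path_edges [] = {}"
  by (simp add: path_edges_conv_image)

lemma path_edges_Cons:
  "path_edges (a # p) = (if p = [] then {} else insert {a, hd p} (path_edges p))"
proof (cases p)
  case (Cons b q)
  have "{..<Suc (length q)} = insert 0 (Suc ` {..<length q})"
    by (simp add: lessThan_Suc_eq_insert_0)
  then show ?thesis by (simp add: path_edges_conv_image Cons image_image)
qed (simp add: path_edges_conv_image)

lemma path_edges_append:
  assumes "p \<noteq> []" "q \<noteq> []"
  shows "path_edges (p @ q) = insert {last p, hd q} (path_edges p \<union> path_edges q)"
  using assms
proof (induction p)
  case (Cons a p)
  then show ?case by (cases "p = []") (auto simp: path_edges_Cons)
qed simp

lemma path_edges_rev: "path_edges (rev p) = path_edges p"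
proof (induction p)
  case (Cons a p)
  show ?case
  proof (cases "p = []")
    case False
    then show ?thesis
      by (simp add: path_edges_append Cons path_edges_Cons last_rev insert_commute)
  qed (simp add: path_edges_Cons)
qed simp

lemma path_edges_map: "path_edges (map f p) = image f ` path_edges p"
proof (induction p)
  case (Cons a p)
  then show ?case by (auto simp: path_edges_Cons hd_map)
qed simp

lemma path_edges_subset_set: "e \<in> path_edges p \<Longrightarrow> e \<subseteq> set p"
  by (auto simp: path_edges_def)

text \<open>Positions \<open>0\<close> and \<open>length p - 1\<close> are not consecutive once
  there are three vertices. Hence the closing edge counts as exactly one additional edge.\<close>

lemma closing_edge_notin_path_edges:
  assumes "distinct p" "length p \<ge> 3"
  shows "{last p, hd p} \<notin> path_edges p"
proof
  assume "{last p, hd p} \<in> path_edges p"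
  then obtain i where i: "Suc i < length p" "{last p, hd p} = {p ! i, p ! Suc i}"
    by (auto simp: path_edges_def)
  have "p \<noteq> []" using assms by auto
  then have "{p ! (length p - 1), p ! 0} = {p ! i, p ! Suc i}"
    using i by (simp add: last_conv_nth hd_conv_nth)
  moreover have "p ! j = p ! l \<longleftrightarrow> j = l" if "j < length p" "l < length p" for j l
    using assms that by (simp add: nth_eq_iff_index_eq)
  ultimately show False
    using i assms by (fastforce simp: doubleton_eq_iff)
qed

lemma cycle_edges_swap:
  assumes "p \<noteq> []" "q \<noteq> []"
  shows "cycle_edges (q @ p) = cycle_edges (p @ q)"
  using assms by (auto simp: cycle_edges_def path_edges_append)

lemma cycle_edges_rev: "cycle_edges (rev p) = cycle_edges p"
  by (cases "p = []") (auto simp: cycle_edges_def path_edges_rev hd_rev last_rev insert_commute)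

text \<open>Rotating the list turns any chosen edge into the closing one; reversal, if necessary,
  then gives it the wanted direction.\<close>

lemma cycle_cut:
  assumes "{u, w} \<in> cycle_edges p" "distinct p" "p \<noteq> []"
  obtains q where "distinct q" "set q = set p" "length q = length p"
    "cycle_edges q = cycle_edges p" "hd q = u" "last q = w"
proof -
  have "\<exists>q. distinct q \<and> set q = set p \<and> length q = length p \<and> cycle_edges q = cycle_edges p
        \<and> {last q, hd q} = {u, w}"
  proof (cases "{u, w} = {last p, hd p}")
    case True
    then show ?thesis using assms by blast
  next
    case False
    then obtain i where i: "Suc i < length p" "{u, w} = {p ! i, p ! Suc i}"
      using assms by (auto simp: cycle_edges_def path_edges_def)
    let ?s = "take (Suc i) p" and ?t = "drop (Suc i) p"
    have ne: "?s \<noteq> []" "?t \<noteq> []" using i by auto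
    have "cycle_edges (?t @ ?s) = cycle_edges p"
      using cycle_edges_swap[OF ne] by simp
    moreover have "last (?t @ ?s) = p ! i" using i by (simp add: last_append take_Suc_conv_app_nth)
    moreover have "hd (?t @ ?s) = p ! Suc i" using i ne by (simp add: hd_drop_conv_nth)
    moreover have "set (?t @ ?s) = set (?s @ ?t)" "distinct (?t @ ?s) = distinct (?s @ ?t)"
      by (simp_all only: set_append distinct_append Un_commute Int_commute) blast+
    then have "set (?t @ ?s) = set p" "distinct (?t @ ?s)" using assms by simp_all
    moreover have "length (?t @ ?s) = length p" using i by simp
    ultimately show ?thesis using i(2) by metis
  qed
  then obtain q where q: "distinct q" "set q = set p" "length q = length p"
      "cycle_edges q = cycle_edges p" "{last q, hd q} = {u, w}" by blast
  then have "q \<noteq> []" using assms by auto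
  then show thesis
    using q that[of q] that[of "rev q"]
    by (auto simp: doubleton_eq_iff cycle_edges_rev hd_rev last_rev)
qed

text \<open>A connectedness argument: each step preserves membership in \<open>S\<close>, so one
  vertex decides for all. It will show that a cycle cannot miss two gaps.\<close>

lemma path_stays_in_closed_set:
  assumes "\<And>u w. {u, w} \<in> path_edges p \<Longrightarrow> u \<in> S \<longleftrightarrow> w \<in> S"
  shows "set p \<subseteq> S \<or> set p \<inter> S = {}"
  using assms
proof (induction p)
  case (Cons a p)
  show ?case
  proof (cases "p = []")
    case False
    then have "a \<in> S \<longleftrightarrow> hd p \<in> S" "hd p \<in> set p"
      using Cons.prems[of a "hd p"] by (simp_all add: path_edges_Cons)
    moreover have "set p \<subseteq> S \<or> set p \<inter> S = {}"
      using Cons.prems False by (intro Cons.IH) (simp add: path_edges_Cons)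
    ultimately show ?thesis by auto
  qed auto
qed simp

section \<open>Columns and gaps of a two-stripe circulant graph\<close>

text \<open>Here \<open>c\<close> is the \<open>g1\<close> of the theorem, the number of columns,
  and \<open>r\<close> is their length. Since \<open>c\<close> is \<open>gcd n a1\<close>, its
  coprimality with \<open>a2\<close> is the standing assumption on the gcd of all three
  parameters.\<close>

locale two_stripe =
  fixes n a1 a2 c r :: int
  assumes n_ge_3: "n \<ge> 3"
    and c_def: "c = gcd n a1"
    and r_def: "r = n div c"
    and c_gt_1: "c > 1"
    and coprime_c_a2: "coprime c a2"
begin

lemma n_eq: "n = r * c"
  by (simp add: r_def c_def)

lemma n_pos: "n > 0" using n_ge_3 by simp

lemma r_pos: "r > 0"
  using n_pos c_gt_1 n_eq by (simp add: zero_less_mult_iff)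

lemma c_dvd [simp]: "c dvd n" "c dvd a1"
  by (simp_all add: c_def)

definition a2_inv :: int where "a2_inv = (SOME y. [a2 * y = 1] (mod c))"

lemma a2_inv: "[a2 * a2_inv = 1] (mod c)"
  unfolding a2_inv_def using cong_solve_coprime_int[of a2 c] coprime_c_a2
  by (metis coprime_commute someI_ex)

text \<open>The cosets of the subgroup generated by \<open>a1\<close> are the residue classes modulo
  \<open>c\<close>. Multiplying by the inverse of \<open>a2\<close> numbers them so that a step of
  \<open>a2\<close> leads to the next column.\<close>

definition column :: "int \<Rightarrow> int" where "column v = (a2_inv * v) mod c"

lemma column_bounds: "0 \<le> column v" "column v < c"
  using c_gt_1 by (simp_all add: column_def)

lemma column_mod_n [simp]: "column (v mod n) = column v"
  unfolding column_def by (metis c_dvd(1) mod_mod_cancel mod_mult_right_eq)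

lemma column_add: "column (v + i * a1 + j * a2) = (column v + j) mod c"
proof -
  have "[a2_inv * (v + i * a1 + j * a2) = a2_inv * v + 0 + j * 1] (mod c)"
  proof -
    have "a2_inv * (v + i * a1 + j * a2) = a2_inv * v + a2_inv * i * a1 + j * (a2 * a2_inv)"
      by (simp add: algebra_simps)
    also have "[\<dots> = a2_inv * v + 0 + j * 1] (mod c)"
      by (intro cong_add cong_mult a2_inv cong_refl) (simp add: cong_0_iff)
    finally show ?thesis .
  qed
  then show ?thesis by (simp add: column_def cong_def mod_add_left_eq)
qed

lemma column_add_a1 [simp]: "column (v + a1) = column v" "column (v - a1) = column v"
  using column_add[of v 1 0] column_add[of v "-1" 0] column_bounds[of v] by simp_all

lemma column_add_a2: "column (v + a2) = (column v + 1) mod c"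
  using column_add[of v 0 1] by simp

text \<open>Indexing is cyclic: gap \<open>c - 1\<close> leads from the last column back to column
  \<open>0\<close>.\<close>

definition gap :: "int \<Rightarrow> int set set" where
  "gap j = {{v, (v + a2) mod n} | v. v \<in> circulant_vertices n \<and> column v = j}"

lemma mod_n_in_vertices [simp]: "v mod n \<in> circulant_vertices n"
  using n_pos by (simp add: circulant_vertices_def)

lemma mod_n_vertex [simp]: "v \<in> circulant_vertices n \<Longrightarrow> v mod n = v"
  by (simp add: circulant_vertices_def)

lemma circulant_stripe_alt:
  "circulant_stripe n a = {{v, (v + a) mod n} | v. v \<in> circulant_vertices n}"
proof -
  have "\<exists>w. {v, (v - a) mod n} = {w, (w + a) mod n} \<and> w \<in> circulant_vertices n"
    if "v \<in> circulant_vertices n" for v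
    using that by (intro exI[of _ "(v - a) mod n"]) (auto simp: mod_add_left_eq)
  then show ?thesis unfolding circulant_stripe_def by blast
qed

lemma stripe_eq_UN_gap: "circulant_stripe n a2 = (\<Union>j\<in>{0..<c}. gap j)"
  unfolding circulant_stripe_alt gap_def using column_bounds by fastforce

lemma same_column_if_a1_stripe:
  assumes "{u, w} \<in> circulant_stripe n a1"
  shows "column u = column w"
  using assms by (auto simp: circulant_stripe_alt doubleton_eq_iff)

lemma gap_columns:
  assumes "{u, w} \<in> gap j"
  shows "column u = j \<and> column w = (j + 1) mod c \<or> column w = j \<and> column u = (j + 1) mod c"
  using assms by (auto simp: gap_def doubleton_eq_iff column_add_a2)

lemma add_mod_c_neq: "0 < d \<Longrightarrow> d < c \<Longrightarrow> (j + d) mod c \<noteq> j mod c"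
  using zdvd_not_zless[of d c] by (auto simp: mod_eq_dvd_iff)

lemma stripes_disjoint: "circulant_stripe n a1 \<inter> circulant_stripe n a2 = {}"
proof -
  have False if e_in: "e \<in> circulant_stripe n a1" "e \<in> gap j" "j \<in> {0..<c}" for e j
  proof -
    obtain u w where e: "e = {u, w}" using e_in(2) unfolding gap_def by blast
    then show False
      using same_column_if_a1_stripe[of u w] gap_columns[of u w j] that
        add_mod_c_neq[of 1 j] c_gt_1 by auto
  qed
  then show ?thesis unfolding stripe_eq_UN_gap by blast
qed

text \<open>A common edge of two different gaps would be traversed in opposite directions, so two
  steps of \<open>a2\<close> would return to the same column. This is impossible for
  \<open>c > 2\<close>.\<close>

lemma gaps_disjoint:
  assumes "c > 2" "i \<in> {0..<c}" "j \<in> {0..<c}" "i \<noteq> j"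
  shows "gap i \<inter> gap j = {}"
proof -
  have False if e_in: "e \<in> gap i" "e \<in> gap j" for e
  proof -
    obtain u w where e: "e = {u, w}" using e_in(1) unfolding gap_def by blast
    have "i = (j + 1) mod c" "j = (i + 1) mod c"
      using gap_columns[of u w i] gap_columns[of u w j] that e assms by auto
    then have "(i + 2) mod c = i mod c"
      using assms by (metis add.assoc mod_add_left_eq mod_mod_trivial one_add_one)
    then show False using add_mod_c_neq[of 2 i] assms by simp
  qed
  then show ?thesis by blast
qed

section \<open>Unrolling the circulant graph onto the cylinder\<close>

definition vertex :: "int \<Rightarrow> int \<times> int \<Rightarrow> int" where
  "vertex s = (\<lambda>(i, j). (s + i * a1 + j * a2) mod n)"

text \<open>Dividing by \<open>c\<close> leaves the multiplier \<open>a1 div c\<close>, which is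
  coprime to \<open>r\<close>. Thus \<open>a1\<close> has additive order \<open>r\<close> modulo
  \<open>n\<close>, matching the period of the rows.\<close>

lemma a1_multiple_cong_iff: "[i * a1 = i' * a1] (mod n) \<longleftrightarrow> [i = i'] (mod r)"
proof -
  have "coprime (a1 div c) r"
    unfolding r_def c_def using n_pos
    by (metis coprime_commute div_gcd_coprime less_irrefl)
  moreover have "i * a1 - i' * a1 = ((i - i') * (a1 div c)) * c"
    by (simp add: left_diff_distrib mult.assoc)
  ultimately show ?thesis
    using c_gt_1 by (simp add: cong_iff_dvd_diff n_eq coprime_dvd_mult_left_iff coprime_commute)
qed

text \<open>The column number determines \<open>j\<close>, then the order of \<open>a1\<close>
  determines \<open>i\<close>; surjectivity follows by counting, as \<open>r * c = n\<close>. The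
  base point \<open>s\<close> stays free so that any vertex can become the image of the
  origin.\<close>

lemma bij_betw_vertex: "bij_betw (vertex s) (cylinder_vertices r c) (circulant_vertices n)"
proof -
  have inj: "inj_on (vertex s) (cylinder_vertices r c)"
  proof (rule inj_onI, clarify)
    fix i j i' j'
    assume *: "(i, j) \<in> cylinder_vertices r c" "(i', j') \<in> cylinder_vertices r c"
      "vertex s (i, j) = vertex s (i', j')"
    then have "column (s + i * a1 + j * a2) = column (s + i' * a1 + j' * a2)"
      unfolding vertex_def by (metis case_prod_conv column_mod_n)
    then have "[column s + j = column s + j'] (mod c)" by (simp add: column_add cong_def)
    then have "[j = j'] (mod c)" by (simp only: cong_add_lcancel)
    then have j: "j = j'" using * by (simp add: cylinder_vertices_def cong_def)
    then have "[i * a1 + (s + j * a2) = i' * a1 + (s + j * a2)] (mod n)"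
      using * by (simp add: vertex_def cong_def algebra_simps)
    then have "[i = i'] (mod r)" by (simp only: cong_add_rcancel a1_multiple_cong_iff)
    then show "i = i' \<and> j = j'"
      using * j by (simp add: cylinder_vertices_def cong_def)
  qed
  have "vertex s ` cylinder_vertices r c = circulant_vertices n"
  proof (rule card_subset_eq)
    have "nat r * nat c = nat n" using r_pos n_eq by (simp add: nat_mult_distrib)
    then show "card (vertex s ` cylinder_vertices r c) = card (circulant_vertices n)"
      using inj by (simp add: card_image cylinder_vertices_def circulant_vertices_def)
  qed (auto simp: circulant_vertices_def vertex_def n_pos)
  then show ?thesis using inj by (simp add: bij_betw_def)
qed

lemma vertex_edges_inj:
  assumes "F \<subseteq> Pow (cylinder_vertices r c)"
  shows "inj_on (image (vertex s)) F"
  using assms bij_betw_vertex[of s] inj_on_image_Pow inj_on_subset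
  unfolding bij_betw_def by blast

lemma vertex_row_mod: "vertex s (i mod r, j) = vertex s (i, j)"
proof -
  have "[i mod r * a1 = i * a1] (mod n)" by (simp add: a1_multiple_cong_iff)
  then show ?thesis unfolding vertex_def case_prod_conv cong_def[symmetric]
    by (intro cong_add) simp_all
qed

lemma vertex_step:
  "vertex s (i + 1, j) = (vertex s (i, j) + a1) mod n"
  "vertex s (i, j + 1) = (vertex s (i, j) + a2) mod n"
  unfolding vertex_def case_prod_conv mod_add_left_eq by (simp_all add: algebra_simps)

lemma vertical_edges_alt:
  "vertical_edges r c = {{(i, j), ((i + 1) mod r, j)} | i j. (i, j) \<in> cylinder_vertices r c}"
proof -
  have "\<exists>k. {(i, j), ((i - 1) mod r, j)} = {(k, j), ((k + 1) mod r, j)}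
            \<and> (k, j) \<in> cylinder_vertices r c"
    if "(i, j) \<in> cylinder_vertices r c" for i j
    using that r_pos pos_mod_bound[of r "i - 1"]
    by (intro exI[of _ "(i - 1) mod r"])
       (auto simp: cylinder_vertices_def mod_add_left_eq insert_commute)
  then show ?thesis unfolding vertical_edges_def by blast
qed

lemma horizontal_edges_alt:
  "horizontal_edges r c = {{(i, j), (i, j + 1)} | i j. (i, j) \<in> cylinder_vertices r c \<and> j < c - 1}"
proof -
  have "\<exists>k. {(i, j), (i, j - 1)} = {(i, k), (i, k + 1)}
            \<and> (i, k) \<in> cylinder_vertices r c \<and> k < c - 1"
    if "(i, j) \<in> cylinder_vertices r c" "j > 0" for i j
    using that by (intro exI[of _ "j - 1"]) (auto simp: cylinder_vertices_def)
  then show ?thesis unfolding horizontal_edges_def by blast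
qed

lemma cylinder_edges_subset: "cylinder_edges r c \<subseteq> Pow (cylinder_vertices r c)"
  using r_pos unfolding cylinder_edges_def vertical_edges_alt horizontal_edges_alt
  by (auto simp: cylinder_vertices_def)

lemma vertex_in_vertices: "vertex s u \<in> circulant_vertices n"
  by (simp add: vertex_def split_beta)

lemma vertical_image: "image (vertex s) ` vertical_edges r c = circulant_stripe n a1"
proof -
  have "vertical_edges r c = (\<lambda>u. {u, ((fst u + 1) mod r, snd u)}) ` cylinder_vertices r c"
    unfolding vertical_edges_alt by force
  then have "image (vertex s) ` vertical_edges r c
      = (\<lambda>v. {v, (v + a1) mod n}) ` vertex s ` cylinder_vertices r c"
    by (simp add: image_image vertex_row_mod vertex_step)
  also have "\<dots> = circulant_stripe n a1"
    using bij_betw_vertex[of s] unfolding circulant_stripe_alt bij_betw_def by blast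
  finally show ?thesis .
qed

lemma horizontal_edge_image:
  "vertex s ` {(i, j), (i, j + 1)} = {vertex s (i, j), (vertex s (i, j) + a2) mod n}"
  by (simp add: vertex_step)

lemma horizontal_image_subset: "image (vertex s) ` horizontal_edges r c \<subseteq> circulant_stripe n a2"
proof (rule image_subsetI)
  fix f assume "f \<in> horizontal_edges r c"
  then obtain i j where "f = {(i, j), (i, j + 1)}" unfolding horizontal_edges_alt by blast
  then show "vertex s ` f \<in> circulant_stripe n a2"
    using vertex_in_vertices[of s "(i, j)"] unfolding circulant_stripe_alt
    by (auto simp only: horizontal_edge_image)
qed

text \<open>Unlike the vertical edges, the horizontal ones do not wrap around. An edge of length
  \<open>a2\<close> outside the image has to start in the image of column \<open>c - 1\<close>,
  whose column number is that of \<open>s - a2\<close>.\<close>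

lemma stripe_minus_gap_subset:
  "circulant_stripe n a2 - gap (column (s - a2)) \<subseteq> image (vertex s) ` horizontal_edges r c"
proof
  fix e assume e: "e \<in> circulant_stripe n a2 - gap (column (s - a2))"
  then obtain v where v: "e = {v, (v + a2) mod n}" "v \<in> circulant_vertices n"
    by (auto simp: circulant_stripe_alt)
  then have nc: "column v \<noteq> column (s - a2)" using e by (auto simp: gap_def)
  obtain i j where ij: "(i, j) \<in> cylinder_vertices r c" "v = vertex s (i, j)"
    using v(2) bij_betw_vertex[of s] unfolding bij_betw_def by fastforce
  have "j \<noteq> c - 1"
  proof
    assume "j = c - 1"
    then have "column v = (column s + (c - 1)) mod c"
      using ij by (simp add: vertex_def column_add)
    also have "\<dots> = (column s + -1) mod c"
      by (simp add: mod_eq_dvd_iff)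
    also have "\<dots> = column (s - a2)" using column_add[of s 0 "-1"] by simp
    finally show False using nc by simp
  qed
  then have "{(i, j), (i, j + 1)} \<in> horizontal_edges r c"
    using ij(1) unfolding horizontal_edges_alt cylinder_vertices_def by fastforce
  moreover have "e = vertex s ` {(i, j), (i, j + 1)}"
    using v ij horizontal_edge_image by simp
  ultimately show "e \<in> image (vertex s) ` horizontal_edges r c" by blast
qed

section \<open>Closing paths and cutting cycles\<close>

text \<open>By the congruence, \<open>x\<close> steps of \<open>a1\<close> undo \<open>c\<close>
  steps of \<open>a2\<close>. With only \<open>c - 1\<close> of the latter, one arrives a single
  step of \<open>a2\<close> before \<open>s\<close>, and that missing step is the closing
  edge.\<close>

lemma vertex_last:
  assumes "[x * a1 = - c * a2] (mod n)"
  shows "vertex s (x, c - 1) = (s - a2) mod n"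
proof -
  have "[s + x * a1 + (c - 1) * a2 = s + (- c * a2) + (c - 1) * a2] (mod n)"
    using assms by (intro cong_add) simp_all
  then show ?thesis by (simp add: vertex_def cong_def algebra_simps)
qed

lemma vertex_origin: "vertex s (0, 0) = s mod n"
  by (simp add: vertex_def)

text \<open>The closing edge costs one and every other edge keeps its cost, which explains the shift
  from \<open>k\<close> to \<open>k - 1\<close>. Both directions use this: it closes a given path,
  and it computes the cost of a cycle that has been cut.\<close>

lemma tour_cost_closed_path:
  assumes "distinct q" "set q = cylinder_vertices r c" "path_edges q \<subseteq> cylinder_edges r c"
    "hd q = (0, 0)" "last q = (x, c - 1)" "[x * a1 = - c * a2] (mod n)"
  shows "tour_cost n a2 (map (vertex s) q) = Suc (card (path_edges q \<inter> horizontal_edges r c))"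
    and "hamiltonian_cycle (circulant_vertices n) (two_stripe_edges n a1 a2) (map (vertex s) q)"
proof -
  let ?p = "map (vertex s) q"
  let ?e = "{last ?p, hd ?p}"
  have bij: "inj_on (vertex s) (set q)" "vertex s ` set q = circulant_vertices n"
    using bij_betw_vertex[of s] assms(2) by (simp_all add: bij_betw_def)
  have p: "distinct ?p" "set ?p = circulant_vertices n"
    using bij assms(1) by (simp_all add: distinct_map)
  have "length ?p = card (set ?p)" using p(1) distinct_card by metis
  then have len: "length ?p \<ge> 3"
    using n_ge_3 p(2) by (simp add: circulant_vertices_def)
  then have "q \<noteq> []" by auto
  then have "last ?p = (s - a2) mod n" "hd ?p = s mod n"
    using assms(4-6) by (simp_all add: last_map hd_map vertex_last vertex_origin)
  then have e: "?e \<in> circulant_stripe n a2"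
    unfolding circulant_stripe_alt by (auto simp: mod_add_left_eq intro!: exI[of _ "(s - a2) mod n"])
  have e': "?e \<notin> path_edges ?p"
    by (rule closing_edge_notin_path_edges[OF p(1) len])
  have img: "path_edges ?p = image (vertex s) ` path_edges q" by (rule path_edges_map)
  have vertex_vertical: "vertex s ` f \<in> circulant_stripe n a1" if "f \<in> vertical_edges r c" for f
    using vertical_image[of s] that by (metis imageI)
  have vertex_horizontal: "vertex s ` f \<in> circulant_stripe n a2" if "f \<in> horizontal_edges r c" for f
    by (rule subsetD[OF horizontal_image_subset imageI[OF that]])
  \<comment> \<open>The implication from left to right rests on disjointness of the stripes: the
    image of a vertical edge is never counted.\<close>
  have stripe: "vertex s ` f \<in> circulant_stripe n a2 \<longleftrightarrow> f \<in> horizontal_edges r c"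
    if "f \<in> path_edges q" for f
    using subsetD[OF assms(3) that] vertex_horizontal[of f] vertex_vertical[of f] stripes_disjoint
    by (auto simp: cylinder_edges_def)
  then have "path_edges ?p \<inter> circulant_stripe n a2
      = image (vertex s) ` (path_edges q \<inter> horizontal_edges r c)"
    unfolding img by blast
  moreover have "inj_on (image (vertex s)) (path_edges q \<inter> horizontal_edges r c)"
    using assms(3) cylinder_edges_subset by (intro vertex_edges_inj) blast
  ultimately have "card (path_edges ?p \<inter> circulant_stripe n a2)
      = card (path_edges q \<inter> horizontal_edges r c)"
    by (simp add: card_image)
  moreover have "cycle_edges ?p \<inter> circulant_stripe n a2
      = insert ?e (path_edges ?p \<inter> circulant_stripe n a2)"
    using e by (auto simp: cycle_edges_def)
  ultimately show "tour_cost n a2 ?p = Suc (card (path_edges q \<inter> horizontal_edges r c))"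
    using e' by (simp add: tour_cost_def)
  have "path_edges ?p \<subseteq> two_stripe_edges n a1 a2"
    using assms(3) vertex_vertical vertex_horizontal
    by (auto simp: img two_stripe_edges_def cylinder_edges_def)
  then show "hamiltonian_cycle (circulant_vertices n) (two_stripe_edges n a1 a2) ?p"
    using len p e unfolding hamiltonian_cycle_def cycle_edges_def two_stripe_edges_def by blast
qed

section \<open>Crossings of the gaps by a Hamiltonian cycle\<close>

lemma empty_gap_unique:
  assumes "hamiltonian_cycle (circulant_vertices n) (two_stripe_edges n a1 a2) p"
    and "i \<in> {0..<c}" "j \<in> {0..<c}" "i < j"
    and "cycle_edges p \<inter> gap i = {}" "cycle_edges p \<inter> gap j = {}"
  shows False
proof -
  \<comment> \<open>\<open>S\<close> is the block of columns \<open>i + 1\<close> to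
    \<open>j\<close>, whose only exits are the gaps \<open>i\<close> and \<open>j\<close>.\<close>
  define S where "S = {v. i < column v \<and> column v \<le> j}"
  have p: "set p = circulant_vertices n" "path_edges p \<subseteq> cycle_edges p"
    "cycle_edges p \<subseteq> two_stripe_edges n a1 a2"
    using assms(1) by (auto simp: hamiltonian_cycle_def cycle_edges_def)
  have "u \<in> S \<longleftrightarrow> w \<in> S" if uw: "{u, w} \<in> path_edges p" for u w
  proof (cases "{u, w} \<in> circulant_stripe n a1")
    case True
    then show ?thesis using same_column_if_a1_stripe by (simp add: S_def)
  next
    case False
    then obtain l where l: "l \<in> {0..<c}" "{u, w} \<in> gap l"
      using uw p stripe_eq_UN_gap unfolding two_stripe_edges_def by blast
    have ne: "l \<noteq> i" "l \<noteq> j" using l uw p assms(5,6) by auto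
    \<comment> \<open>If \<open>l = c - 1\<close>, the next column is \<open>0\<close> and both
      sides are false, since \<open>l\<close> differs from \<open>j\<close>.\<close>
    have step: "i < l \<and> l \<le> j \<longleftrightarrow> i < (l + 1) mod c \<and> (l + 1) mod c \<le> j"
    proof (cases "l = c - 1")
      case True
      then show ?thesis using ne assms(2-4) by simp
    next
      case False
      then have "(l + 1) mod c = l + 1" using l by simp
      then show ?thesis using ne by auto
    qed
    then show ?thesis using gap_columns[OF l(2)] by (auto simp: S_def)
  qed
  then have or: "set p \<subseteq> S \<or> set p \<inter> S = {}" by (rule path_stays_in_closed_set)
  \<comment> \<open>No column is empty, as \<open>l\<close> steps of \<open>a2\<close> from
    \<open>0\<close> reach column \<open>l\<close>. So the path visits column \<open>i\<close>,
    outside \<open>S\<close>, and column \<open>j\<close>, inside \<open>S\<close>.\<close>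
  have "\<exists>v \<in> set p. column v = l" if "l \<in> {0..<c}" for l
  proof
    show "column ((l * a2) mod n) = l"
      unfolding column_mod_n using that column_add[of 0 0 l] by (simp add: column_def)
    show "(l * a2) mod n \<in> set p" using p by simp
  qed
  then obtain v w where "v \<in> set p" "column v = i" "w \<in> set p" "column w = j"
    using assms(2,3) by meson
  then show False using or assms(4) by (auto simp: S_def)
qed

lemma gap_crossed_once:
  assumes ham: "hamiltonian_cycle (circulant_vertices n) (two_stripe_edges n a1 a2) p"
    and cost: "int (tour_cost n a2 p) < 2 * (c - 1)"
  obtains j where "j \<in> {0..<c}" "card (cycle_edges p \<inter> gap j) = 1"
proof (rule ccontr)
  assume "\<not> thesis"
  with that have ne1: "card (cycle_edges p \<inter> gap j) \<noteq> 1" if "j \<in> {0..<c}" for j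
    using that by blast
  \<comment> \<open>\<open>j0\<close> is the missed gap if there is one, and otherwise an arbitrary
    gap, here \<open>0\<close>.\<close>
  have "\<exists>j0 \<in> {0..<c}. \<forall>j \<in> {0..<c} - {j0}. cycle_edges p \<inter> gap j \<noteq> {}"
  proof (cases "\<exists>j0 \<in> {0..<c}. cycle_edges p \<inter> gap j0 = {}")
    case True
    then obtain j0 where j0: "j0 \<in> {0..<c}" "cycle_edges p \<inter> gap j0 = {}" by blast
    have "cycle_edges p \<inter> gap j \<noteq> {}" if "j \<in> {0..<c} - {j0}" for j
      using that j0 empty_gap_unique[OF ham, of j j0] empty_gap_unique[OF ham, of j0 j]
      by (cases "j < j0") auto
    then show ?thesis using j0 by blast
  next
    case False
    then show ?thesis using c_gt_1 by (intro bexI[of _ 0]) auto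
  qed
  then obtain j0 where j0: "j0 \<in> {0..<c}"
    "\<And>j. j \<in> {0..<c} - {j0} \<Longrightarrow> cycle_edges p \<inter> gap j \<noteq> {}" by blast
  define J where "J = {0..<c} - {j0}"
  have ge2: "card (cycle_edges p \<inter> gap j) \<ge> 2" if "j \<in> J" for j
  proof -
    have "card (cycle_edges p \<inter> gap j) \<noteq> 0" using j0(2) that by (simp add: J_def)
    then show ?thesis using ne1[of j] that unfolding J_def by fastforce
  qed
  \<comment> \<open>For \<open>c = 2\<close> and \<open>a2 = n / 2\<close> the two gaps coincide, but then \<open>J\<close> is a singleton.\<close>
  have disj: "gap i \<inter> gap j = {}" if "i \<in> J" "j \<in> J" "i \<noteq> j" for i j
  proof (rule gaps_disjoint)
    show "c > 2"
      using that j0(1) by (auto simp: J_def)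
  qed (use that in \<open>auto simp: J_def\<close>)
  have "card J * 2 \<le> (\<Sum>j\<in>J. card (cycle_edges p \<inter> gap j))"
    using sum_bounded_below[of J 2 "\<lambda>j. card (cycle_edges p \<inter> gap j)"] ge2 by simp
  also have "\<dots> = card (\<Union>j\<in>J. cycle_edges p \<inter> gap j)"
  proof (rule card_UN_disjoint[symmetric])
    show "\<forall>i\<in>J. \<forall>j\<in>J. i \<noteq> j \<longrightarrow> cycle_edges p \<inter> gap i \<inter> (cycle_edges p \<inter> gap j) = {}"
      using disj by blast
  qed (simp_all add: J_def)
  \<comment> \<open>Edges in gap \<open>j0\<close> alone are discarded; a lower bound on the cost
    suffices.\<close>
  also have "\<dots> \<le> tour_cost n a2 p"
    unfolding tour_cost_def stripe_eq_UN_gap by (rule card_mono) (auto simp: J_def)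
  finally have "int (card J) * 2 \<le> int (tour_cost n a2 p)" by linarith
  moreover have "int (card J) = c - 1" using j0(1) c_gt_1 by (simp add: J_def)
  ultimately show False using cost by simp
qed

section \<open>From a cheap cycle to a cylinder path\<close>

lemma hamiltonian_path_of_cheap_cycle:
  assumes ham: "hamiltonian_cycle (circulant_vertices n) (two_stripe_edges n a1 a2) p"
    and cost: "int (tour_cost n a2 p) < 2 * (c - 1)"
    and x: "x \<in> {0..r - 1}" "[x * a1 = - c * a2] (mod n)"
  obtains q where "hamiltonian_path (cylinder_vertices r c) (cylinder_edges r c) q"
    "tour_cost n a2 p = Suc (card (path_edges q \<inter> horizontal_edges r c))"
    "hd q = (0, 0)" "last q = (x, c - 1)"
proof -
  obtain j where j: "j \<in> {0..<c}" "card (cycle_edges p \<inter> gap j) = 1"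
    using gap_crossed_once[OF ham cost] .
  then obtain e where e: "cycle_edges p \<inter> gap j = {e}" using card_1_singletonE by blast
  then obtain v where v: "e = {v, (v + a2) mod n}" "v \<in> circulant_vertices n" "column v = j"
    by (auto simp: gap_def)
  \<comment> \<open>With this base point the far end \<open>s\<close> of the cut edge is the image
    of the origin, and its near end \<open>v\<close>, which is \<open>s - a2\<close> modulo
    \<open>n\<close>, is the image of \<open>(x, c - 1)\<close>.\<close>
  define s where "s = (v + a2) mod n"
  have p: "distinct p" "set p = circulant_vertices n" "length p \<ge> 3"
    "cycle_edges p \<subseteq> two_stripe_edges n a1 a2"
    using ham by (auto simp: hamiltonian_cycle_def)
  then have "p \<noteq> []" by auto
  moreover have "{s, v} \<in> cycle_edges p"
    using e v by (auto simp: s_def insert_commute)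
  ultimately obtain p' where p': "distinct p'" "set p' = set p" "length p' = length p"
    "cycle_edges p' = cycle_edges p" "hd p' = s" "last p' = v"
    using cycle_cut[of s v p] p(1) by metis
  have v_s: "(s - a2) mod n = v" using v by (simp add: s_def mod_diff_left_eq)
  then have "column (s - a2) = j" using v(3) column_mod_n by metis
  \<comment> \<open>The cut edge is the only one of the cycle in gap \<open>j\<close>. As it does
    not recur inside the path, the path avoids the whole gap, hence all edges that the cylinder may
    lack.\<close>
  have "{last p', hd p'} \<notin> path_edges p'"
    using closing_edge_notin_path_edges p p' by metis
  then have "e \<notin> path_edges p'" using p' v by (simp add: s_def)
  moreover have p'_sub: "path_edges p' \<subseteq> cycle_edges p" using p'(4) by (auto simp: cycle_edges_def)
  ultimately have "path_edges p' \<inter> gap j = {}" "path_edges p' \<subseteq> two_stripe_edges n a1 a2"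
    using e p(4) p'_sub by auto
  then have p'_image: "path_edges p' \<subseteq> image (vertex s) ` cylinder_edges r c"
    using stripe_minus_gap_subset[of s] vertical_image[of s] \<open>column (s - a2) = j\<close>
    unfolding two_stripe_edges_def cylinder_edges_def image_Un by blast
  define q where "q = map (inv_into (cylinder_vertices r c) (vertex s)) p'"
  have inj: "inj_on (vertex s) (cylinder_vertices r c)"
    and img: "vertex s ` cylinder_vertices r c = circulant_vertices n"
    using bij_betw_vertex[of s] by (simp_all add: bij_betw_def)
  have vq: "map (vertex s) q = p'"
    unfolding q_def map_map using p' p img
    by (intro map_idI) (simp add: f_inv_into_f)
  have set_q: "set q = cylinder_vertices r c"
    using p' p img inj unfolding q_def set_map by (metis inv_into_image_cancel subset_refl)
  have "distinct q" using p'(1) vq by (metis distinct_map)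
  have q_edges: "path_edges q \<subseteq> cylinder_edges r c"
  proof
    fix f assume f: "f \<in> path_edges q"
    then have "vertex s ` f \<in> path_edges p'" using path_edges_map[of "vertex s" q] vq by blast
    then obtain f' where f': "f' \<in> cylinder_edges r c" "vertex s ` f = vertex s ` f'"
      using p'_image by blast
    \<comment> \<open>Equality of the images yields \<open>f = f'\<close> because both edges lie
      inside the cylinder, where \<open>vertex s\<close> is injective.\<close>
    have "f \<subseteq> cylinder_vertices r c" "f' \<subseteq> cylinder_vertices r c"
      using path_edges_subset_set[OF f] set_q cylinder_edges_subset f' by auto
    then show "f \<in> cylinder_edges r c" using f' inj by (metis inj_on_image_eq_iff)
  qed
  have "p' \<noteq> []" using p' \<open>p \<noteq> []\<close> by auto
  have inv: "inv_into (cylinder_vertices r c) (vertex s) w = u"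
    if "u \<in> cylinder_vertices r c" "vertex s u = w" for u w
    using that inj by auto
  have "hd q = (0, 0)"
    unfolding q_def hd_map[OF \<open>p' \<noteq> []\<close>] p'(5)
    using r_pos c_gt_1 by (intro inv) (auto simp: cylinder_vertices_def vertex_origin s_def)
  moreover have "last q = (x, c - 1)"
    unfolding q_def last_map[OF \<open>p' \<noteq> []\<close>] p'(6)
    using x c_gt_1 v_s vertex_last[OF x(2)] by (intro inv) (auto simp: cylinder_vertices_def)
  \<comment> \<open>The original cycle and the closed image of \<open>q\<close> have the same edges,
    so the cost formula for closed paths applies to \<open>p\<close>.\<close>
  moreover have "tour_cost n a2 p = tour_cost n a2 (map (vertex s) q)"
    using vq p'(4) by (simp add: tour_cost_def)
  ultimately show thesis
    using that[of q] tour_cost_closed_path(1)[of q x s] x(2)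
      \<open>distinct q\<close> set_q q_edges
    by (simp add: hamiltonian_path_def)
qed

end

theorem theorem2:
  fixes n a1 a2 g1 k x :: int
  assumes "a1 \<in> {1..n div 2}" and "a2 \<in> {1..n div 2}" and "a1 \<noteq> a2"
    and "g1 = gcd n a1"
    and "g1 > 1"
    and "gcd n (gcd a1 a2) = 1"
    and "k < 2 * (g1 - 1)"
    and "x \<in> {0..n div g1 - 1}" and "[x * a1 = - g1 * a2] (mod n)"
  shows "(\<exists>p. hamiltonian_cycle (circulant_vertices n) (two_stripe_edges n a1 a2) p \<and>
            int (tour_cost n a2 p) = k) \<longleftrightarrow>
         (\<exists>q. hamiltonian_path (cylinder_vertices (n div g1) g1) (cylinder_edges (n div g1) g1) q \<and>
            int (card (path_edges q \<inter> horizontal_edges (n div g1) g1)) = k - 1 \<and>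
            hd q = (0, 0) \<and> last q = (x, g1 - 1))"
    (is "?cycle \<longleftrightarrow> ?path")
proof -
  \<comment> \<open>Two distinct lengths in \<open>{1..n div 2}\<close> force \<open>n div 2\<close>
    to be at least \<open>2\<close>.\<close>
  have "n \<ge> 3" using assms(1-3) by auto
  moreover have "coprime g1 a2"
    using assms(4,6) by (simp add: coprime_iff_gcd_eq_1 gcd.assoc)
  ultimately interpret two_stripe n a1 a2 g1 "n div g1"
    using assms(4,5) by unfold_locales simp_all
  show ?thesis
  proof
    assume ?cycle
    then obtain p where p: "int (tour_cost n a2 p) = k"
      "hamiltonian_cycle (circulant_vertices n) (two_stripe_edges n a1 a2) p" by blast
    then have "int (tour_cost n a2 p) < 2 * (g1 - 1)" using assms(7) by simp
    from hamiltonian_path_of_cheap_cycle[OF p(2) this assms(8,9)] show ?path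
      using p(1) by fastforce
  next
    assume ?path
    then obtain q where q: "distinct q" "set q = cylinder_vertices (n div g1) g1"
      "path_edges q \<subseteq> cylinder_edges (n div g1) g1" "hd q = (0, 0)" "last q = (x, g1 - 1)"
      "int (card (path_edges q \<inter> horizontal_edges (n div g1) g1)) = k - 1"
      by (auto simp: hamiltonian_path_def)
    \<comment> \<open>Every base point closes the path to a cycle; \<open>0\<close> is
      chosen.\<close>
    then show ?cycle
      using tour_cost_closed_path[OF q(1-5) assms(9), of 0]
      by (intro exI[of _ "map (vertex 0) q"]) auto
  qed
qed

end
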